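(* Let $X$ be a separable infinite-dimensional Banach space over $\mathbb{K}$ ($\mathbb{K}=\mathbb{R}$ or $\mathbb{C}$) and let $T \in \mathcal{B}(X)$ be such that $T \oplus T$ is frequently hypercyclic on $X \times X$. Then there exists $S \in \mathcal{B}(X)$ such that $T, S$ are densely d-frequently hypercyclic but $T, S$ fail to be d-weakly mixing.
   Context: $\mathbb{N}$ denotes the set of non-negative integers. $\mathcal{B}(Y)$ is the algebra of bounded linear operators on a Banach space $Y$. For $A \subset \mathbb{N}$, the lower density is $\underline{\mathrm{dens}}\, A := \liminf_{N\to\infty} \frac{\mathrm{card}\{n \le N : n \in A\}}{N}$. An operator $R \in \mathcal{B}(Y)$ is frequently hypercyclic if there is $y \in Y$ such that for every non-empty open $U \subset Y$ the set $\{n \in \mathbb{N} : R^n y \in U\}$ has positive lower density; such a $y$ is called a frequently hypercyclic vector for $R$. $T \oplus S$ is the operator $(x,y)\mapsto (Tx,Sy)$ on $X\times X$ (with the product topology). For $T,S\in\mathcal{B}(X)$, a vector $x \in X$ is a d-frequently hypercyclic vector for $T,S$ if $(x,x)$ is a frequently hypercyclic vector for $T \oplus S$; the operators $T,S$ are d-frequently hypercyclic if such a vector exists, and densely d-frequently hypercyclic if the set of all such vectors is dense in $X$. Operators $R_1,R_2 \in \mathcal{B}(Y)$ are d-topologically transitive on $Y$ if for all non-empty open $U,V_1,V_2 \subset Y$ there is a positive integer $n$ with $U \cap R_1^{-n}(V_1)\cap R_2^{-n}(V_2)\neq\emptyset$. Operators $T,S\in\mathcal{B}(X)$ are d-weakly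 mixing if $T\oplus T,\ S\oplus S$ are d-topologically transitive on $X^2$. *)

theory Defs
  imports "HOL-Analysis.Analysis"
begin

(* The scalar field K, which is R or C.  The norm is the usual absolute value: it is
   multiplicative and extends the one on R, by the class real_normed_field. *)
class real_or_complex = real_normed_field +
  assumes real_or_complex:
    "(\<forall>z. \<exists>a. z = a *\<^sub>R 1) \<or>
     (\<exists>i. i * i = - 1 \<and> (\<forall>z. \<exists>a b. z = a *\<^sub>R 1 + b *\<^sub>R i))"

instance real :: real_or_complex
  by standard simp

instance complex :: real_or_complex
proof
  have "z = Re z *\<^sub>R 1 + Im z *\<^sub>R \<i>" for z :: complex
    by (simp add: complex_eq_iff)
  then show "(\<forall>z::complex. \<exists>a. z = a *\<^sub>R 1) \<or>
     (\<exists>i::complex. i * i = - 1 \<and> (\<forall>z. \<exists>a b. z = a *\<^sub>R 1 + b *\<^sub>R i))"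
    using i_squared by blast
qed

(* The class banach only provides a real Banach space; the locale adds a multiplication by
   scalars of K that extends the real one and for which the norm is a K-norm. *)
locale banach_space_over = vector_space scal
  for scal :: "'k::real_or_complex \<Rightarrow> 'a::banach \<Rightarrow> 'a" +
  assumes scal_of_real: "scal (of_real r) x = r *\<^sub>R x"
    and norm_scal: "norm (scal c x) = norm c * norm x"

definition infinite_dimensional :: "('k::field \<Rightarrow> 'a::ab_group_add \<Rightarrow> 'a) \<Rightarrow> bool" where
  "infinite_dimensional scal \<longleftrightarrow> \<not> (\<exists>B. finite B \<and> module.span scal B = UNIV)"

(* bounded_linear alone only means real-linear and bounded *)
definition bounded_operators ::
  "('k::real_or_complex \<Rightarrow> 'a::banach \<Rightarrow> 'a) \<Rightarrow> ('a \<Rightarrow> 'a) set" where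
  "bounded_operators scal = {T. Vector_Spaces.linear scal scal T \<and> bounded_linear T}"

definition lower_density :: "nat set \<Rightarrow> ereal" where
  "lower_density A = liminf (\<lambda>N. ereal (real (card {n. n \<le> N \<and> n \<in> A}) / real N))"

definition frequently_hypercyclic_vector ::
  "('y::topological_space \<Rightarrow> 'y) \<Rightarrow> 'y \<Rightarrow> bool" where
  "frequently_hypercyclic_vector R y \<longleftrightarrow>
     (\<forall>U. open U \<and> U \<noteq> {} \<longrightarrow> 0 < lower_density {n. (R ^^ n) y \<in> U})"

definition frequently_hypercyclic :: "('y::topological_space \<Rightarrow> 'y) \<Rightarrow> bool" where
  "frequently_hypercyclic R \<longleftrightarrow> (\<exists>y. frequently_hypercyclic_vector R y)"

(* The direct sum of T and S is map_prod T S; the norm of the product type is the l2-sum of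
   the two norms, which induces the product topology. *)
definition d_frequently_hypercyclic_vector ::
  "('a::topological_space \<Rightarrow> 'a) \<Rightarrow> ('a \<Rightarrow> 'a) \<Rightarrow> 'a \<Rightarrow> bool" where
  "d_frequently_hypercyclic_vector T S x \<longleftrightarrow>
     frequently_hypercyclic_vector (map_prod T S) (x, x)"

definition densely_d_frequently_hypercyclic ::
  "('a::topological_space \<Rightarrow> 'a) \<Rightarrow> ('a \<Rightarrow> 'a) \<Rightarrow> bool" where
  "densely_d_frequently_hypercyclic T S \<longleftrightarrow>
     closure {x. d_frequently_hypercyclic_vector T S x} = UNIV"

definition d_topologically_transitive ::
  "('y::topological_space \<Rightarrow> 'y) \<Rightarrow> ('y \<Rightarrow> 'y) \<Rightarrow> bool" where
  "d_topologically_transitive R1 R2 \<longleftrightarrow>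
     (\<forall>U V1 V2. open U \<and> U \<noteq> {} \<and> open V1 \<and> V1 \<noteq> {} \<and> open V2 \<and> V2 \<noteq> {} \<longrightarrow>
        (\<exists>n>0. U \<inter> (R1 ^^ n) -` V1 \<inter> (R2 ^^ n) -` V2 \<noteq> {}))"

definition d_weakly_mixing ::
  "('a::topological_space \<Rightarrow> 'a) \<Rightarrow> ('a \<Rightarrow> 'a) \<Rightarrow> bool" where
  "d_weakly_mixing T S \<longleftrightarrow> d_topologically_transitive (map_prod T T) (map_prod S S)"

end

theory Submission
  imports Defs
begin

text \<open>Let \<open>(w, z)\<close> be a frequently hypercyclic vector for \<open>T \<oplus> T\<close> and take a bounded functional
  \<open>g\<close> with \<open>g z = 1\<close>. Then \<open>S = J T J\<^sup>-\<^sup>1\<close> works, where \<open>J\<^sup>-\<^sup>1 = I + g(\<cdot>) z\<close>: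
  a vector \<open>x\<close> with \<open>g x \<noteq> 0\<close> is d-frequently hypercyclic for \<open>T, S\<close> as soon as \<open>(x, z)\<close> is
  frequently hypercyclic for \<open>T \<oplus> T\<close>. This is the case for \<open>x = c w + T\<^sup>k z\<close> with \<open>c \<noteq> 0\<close>,
  and letting \<open>c\<close> tend to \<open>0\<close> gives a dense set of such \<open>x\<close>, as \<open>z\<close> has a dense orbit.\<close>

section \<open>Bounded functionals\<close>

definition sublinear :: "('a::real_vector \<Rightarrow> real) \<Rightarrow> bool" where
  "sublinear p \<longleftrightarrow>
     (\<forall>x y. p (x + y) \<le> p x + p y) \<and> (\<forall>t\<ge>0. \<forall>x. p (t *\<^sub>R x) \<le> t * p x)"

lemma sublinearI:
  assumes "\<And>x y. p (x + y) \<le> p x + p y"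
    and "\<And>t x. 0 < t \<Longrightarrow> p (t *\<^sub>R x) \<le> t * p x"
    and "p 0 \<le> 0"
  shows "sublinear p"
  unfolding sublinear_def using assms by (metis mult_zero_left order_le_less scaleR_zero_left)

lemma sublinear_add: "sublinear p \<Longrightarrow> p (x + y) \<le> p x + p y"
  by (simp add: sublinear_def)

lemma sublinear_zero:
  assumes "sublinear p"
  shows "p 0 = 0"
proof -
  have "p (0 *\<^sub>R 0) \<le> 0 * p 0"
    using assms unfolding sublinear_def by (metis order_refl)
  then have "p 0 \<le> 0" by simp
  with sublinear_add[OF assms, of 0 0] show ?thesis by simp
qed

text \<open>The reverse inequality is the defining one for \<open>inverse t\<close>, applied to
  \<open>t *\<^sub>R x\<close>. Asking only for an inequality in the definition makes it easy to
  check for infima.\<close>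

lemma sublinear_scaleR:
  assumes "sublinear p" "0 \<le> t"
  shows "p (t *\<^sub>R x) = t * p x"
proof (cases "t = 0")
  case True
  then show ?thesis using sublinear_zero[OF assms(1)] by simp
next
  case False
  with assms have "t > 0" by simp
  have "p (inverse t *\<^sub>R (t *\<^sub>R x)) \<le> inverse t * p (t *\<^sub>R x)"
    using assms unfolding sublinear_def by (metis inverse_nonnegative_iff_nonnegative)
  then have "t * p x \<le> p (t *\<^sub>R x)" using \<open>t > 0\<close> by (simp add: field_simps)
  moreover have "p (t *\<^sub>R x) \<le> t * p x"
    using assms unfolding sublinear_def by simp
  ultimately show ?thesis by simp
qed

lemma sublinear_lower_bound:
  assumes "sublinear p"
  shows "- p (- x) \<le> p x"
  using sublinear_add[OF assms, of x "- x"] sublinear_zero[OF assms] by simp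

text \<open>Two members of a chain, evaluated at different points, are both dominated from below by
  the smaller of them, so subadditivity survives the infimum. The infimum is finite because every
  \<open>q\<close> in \<open>C\<close> satisfies
  \<open>- p (- x) \<le> - q (- x) \<le> q x\<close>.\<close>

lemma sublinear_INF_chain:
  assumes ne: "C \<noteq> {}" and sub: "\<And>q. q \<in> C \<Longrightarrow> sublinear q \<and> q \<le> p"
    and chain: "\<And>q r. q \<in> C \<Longrightarrow> r \<in> C \<Longrightarrow> q \<le> r \<or> r \<le> q"
  shows "sublinear (\<lambda>x. INF q\<in>C. q x)"
    and "q \<in> C \<Longrightarrow> (\<lambda>x. INF q\<in>C. q x) \<le> q"
proof -
  let ?m = "\<lambda>x. INF q\<in>C. q x"
  have bdd: "bdd_below ((\<lambda>q. q x) ` C)" for x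
  proof (rule bdd_belowI2)
    fix q assume "q \<in> C"
    then have "sublinear q" "q (- x) \<le> p (- x)" using sub by (auto simp: le_fun_def)
    then show "- p (- x) \<le> q x" using sublinear_lower_bound[of q x] by simp
  qed
  have low: "?m x \<le> q x" if "q \<in> C" for q x
    using bdd that by (rule cINF_lower)
  show "q \<in> C \<Longrightarrow> ?m \<le> q" using low by (simp add: le_fun_def)
  show "sublinear ?m"
  proof (rule sublinearI)
    fix x y
    have pair: "?m (x + y) \<le> q x + r y" if qr: "q \<in> C" "r \<in> C" for q r
    proof -
      obtain s where s: "s \<in> C" "s \<le> q" "s \<le> r"
        using chain[OF qr] qr order_refl by metis
      have "?m (x + y) \<le> s (x + y)" using low s(1) .
      also have "\<dots> \<le> s x + s y" using sub s(1) sublinear_add by blast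
      also have "\<dots> \<le> q x + r y" using s by (simp add: le_fun_def add_mono)
      finally show ?thesis .
    qed
    have "?m (x + y) - r y \<le> ?m x" if "r \<in> C" for r
      using ne by (rule cINF_greatest) (use pair that in force)
    then have "?m (x + y) - ?m x \<le> ?m y"
      using ne by (intro cINF_greatest) force+
    then show "?m (x + y) \<le> ?m x + ?m y" by simp
  next
    fix t :: real and x assume "0 < t"
    have "?m (t *\<^sub>R x) / t \<le> ?m x"
      using ne
    proof (rule cINF_greatest)
      fix q assume "q \<in> C"
      then have "?m (t *\<^sub>R x) \<le> t * q x"
        using low sub sublinear_scaleR \<open>0 < t\<close> by (metis order_less_imp_le)
      then show "?m (t *\<^sub>R x) / t \<le> q x" using \<open>0 < t\<close> by (simp add: field_simps)
    qed
    then show "?m (t *\<^sub>R x) \<le> t * ?m x" using \<open>0 < t\<close> by (simp add: field_simps)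
  next
    obtain q where "q \<in> C" using ne by blast
    then show "?m 0 \<le> 0" using low[of q 0] sub sublinear_zero by (metis (no_types, lifting))
  qed
qed

text \<open>For sublinear \<open>p\<close> this is the largest sublinear functional below
  \<open>p\<close> whose value at \<open>- a\<close> is at most \<open>- p a\<close>.\<close>

definition tilt :: "'a::real_vector \<Rightarrow> ('a \<Rightarrow> real) \<Rightarrow> 'a \<Rightarrow> real" where
  "tilt a p x = (INF t\<in>{0..}. p (x + t *\<^sub>R a) - t * p a)"

text \<open>The infimum is finite because \<open>t *\<^sub>R a\<close> splits as \<open>- x\<close>
  plus \<open>x + t *\<^sub>R a\<close>. For subadditivity, parameters \<open>s\<close> at
  \<open>x\<close> and \<open>t\<close> at \<open>y\<close> combine to \<open>s + t\<close> at
  \<open>x + y\<close>; for homogeneity, \<open>t\<close> rescales to \<open>r * t\<close>.\<close>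

lemma
  assumes p: "sublinear p"
  shows tilt_le: "0 \<le> t \<Longrightarrow> tilt a p x \<le> p (x + t *\<^sub>R a) - t * p a"
    and sublinear_tilt: "sublinear (tilt a p)"
    and tilt_le_self: "tilt a p \<le> p"
proof -
  have bdd: "bdd_below ((\<lambda>t. p (x + t *\<^sub>R a) - t * p a) ` {0..})" for x
  proof (rule bdd_belowI2)
    fix t :: real assume "t \<in> {0..}"
    then have "t * p a = p (- x + (x + t *\<^sub>R a))"
      using p by (simp add: sublinear_scaleR)
    also have "\<dots> \<le> p (- x) + p (x + t *\<^sub>R a)" using p by (rule sublinear_add)
    finally show "- p (- x) \<le> p (x + t *\<^sub>R a) - t * p a" by simp
  qed
  have low: "tilt a p x \<le> p (x + t *\<^sub>R a) - t * p a" if "0 \<le> t" for t x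
    unfolding tilt_def using bdd by (rule cINF_lower) (use that in simp)
  then show "0 \<le> t \<Longrightarrow> tilt a p x \<le> p (x + t *\<^sub>R a) - t * p a" .
  show "tilt a p \<le> p" using low[of 0] by (simp add: le_fun_def)
  have great: "m \<le> tilt a p x" if "\<And>t. 0 \<le> t \<Longrightarrow> m \<le> p (x + t *\<^sub>R a) - t * p a" for m x
    unfolding tilt_def by (rule cINF_greatest) (use that in auto)
  show "sublinear (tilt a p)"
  proof (rule sublinearI)
    fix x y
    have pair: "tilt a p (x + y) \<le> (p (x + s *\<^sub>R a) - s * p a) + (p (y + t *\<^sub>R a) - t * p a)"
      if "0 \<le> s" "0 \<le> t" for s t
    proof -
      have "tilt a p (x + y) \<le> p ((x + y) + (s + t) *\<^sub>R a) - (s + t) * p a"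
        using low that by simp
      moreover have "p ((x + s *\<^sub>R a) + (y + t *\<^sub>R a)) \<le> p (x + s *\<^sub>R a) + p (y + t *\<^sub>R a)"
        using p by (rule sublinear_add)
      ultimately show ?thesis by (simp add: algebra_simps)
    qed
    have "tilt a p (x + y) - (p (y + t *\<^sub>R a) - t * p a) \<le> tilt a p x" if "0 \<le> t" for t
      by (rule great) (use pair that in \<open>force simp: algebra_simps\<close>)
    then have "tilt a p (x + y) - tilt a p x \<le> tilt a p y"
      by (intro great) (force simp: algebra_simps)
    then show "tilt a p (x + y) \<le> tilt a p x + tilt a p y" by simp
  next
    fix r :: real and x assume r: "0 < r"
    have "tilt a p (r *\<^sub>R x) / r \<le> tilt a p x"
    proof (rule great)
      fix t :: real assume "0 \<le> t"
      then have "tilt a p (r *\<^sub>R x) \<le> p (r *\<^sub>R x + (r * t) *\<^sub>R a) - (r * t) * p a"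
        using low r by simp
      also have "p (r *\<^sub>R x + (r * t) *\<^sub>R a) = r * p (x + t *\<^sub>R a)"
        using sublinear_scaleR[OF p, of r "x + t *\<^sub>R a"] r by (simp add: scaleR_add_right)
      finally show "tilt a p (r *\<^sub>R x) / r \<le> p (x + t *\<^sub>R a) - t * p a"
        using r by (simp add: field_simps)
    qed
    then show "tilt a p (r *\<^sub>R x) \<le> r * tilt a p x" using r by (simp add: field_simps)
  next
    show "tilt a p 0 \<le> 0" using low[of 0 0] sublinear_zero[OF p] by simp
  qed
qed

text \<open>A minimal sublinear functional is unchanged by tilting, and this makes it additive.\<close>
lemma exists_linear_below_sublinear:
  fixes p :: "'a::real_vector \<Rightarrow> real"
  assumes p: "sublinear p"
  obtains f where "linear f" "f \<le> p"
proof -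
  let ?A = "{q. sublinear q \<and> q \<le> p}"
  have "\<exists>m\<in>?A. \<forall>q\<in>?A. q \<le> m \<longrightarrow> q = m"
  proof (rule predicate_Zorn)
    \<comment> \<open>The order is reversed: the maximal element given by Zorn's lemma is a minimal
      functional, and an upper bound of a chain is a functional below all its members.\<close>
    show "partial_order_on ?A (relation_of (\<lambda>m q. q \<le> m) ?A)"
      unfolding partial_order_on_def preorder_on_def refl_on_def trans_def antisym_def relation_of_def
      by auto
    fix C assume "C \<in> Chains (relation_of (\<lambda>m q. q \<le> m) ?A)"
    then have sub: "\<And>q. q \<in> C \<Longrightarrow> sublinear q \<and> q \<le> p"
      and chain: "\<And>q r. q \<in> C \<Longrightarrow> r \<in> C \<Longrightarrow> q \<le> r \<or> r \<le> q"
      unfolding Chains_def relation_of_def by blast+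
    show "\<exists>u\<in>?A. \<forall>q\<in>C. u \<le> q"
    proof (cases "C = {}")
      case True
      then show ?thesis using p by blast
    next
      case False
      note INF = sublinear_INF_chain[OF False sub chain]
      obtain q where "q \<in> C" using False by blast
      then have "(\<lambda>x. INF q\<in>C. q x) \<le> p" using INF(2) sub order_trans by blast
      then show ?thesis using INF by blast
    qed
  qed
  then obtain m where m: "sublinear m" "m \<le> p"
    and min: "\<And>q. sublinear q \<Longrightarrow> q \<le> m \<Longrightarrow> q = m"
    by (auto intro: order_trans)
  have add: "m (x + a) = m x + m a" for x a
  proof -
    have "tilt a m = m"
      by (rule min[OF sublinear_tilt[OF m(1)] tilt_le_self[OF m(1)]])
    \<comment> \<open>The parameter \<open>t = 1\<close> in the infimum gives
      superadditivity.\<close>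
    then have "m x \<le> m (x + a) - m a" using tilt_le[OF m(1), of 1 a x] by simp
    then show ?thesis using sublinear_add[OF m(1), of x a] by simp
  qed
  have neg: "m (- x) = - m x" for x
    using add[of x "- x"] sublinear_zero[OF m(1)] by simp
  have "m (t *\<^sub>R x) = t * m x" for t x
  proof (cases "0 \<le> t")
    case True
    then show ?thesis using m(1) by (rule sublinear_scaleR[rotated])
  next
    case False
    then show ?thesis using sublinear_scaleR[OF m(1), of "- t" x] neg[of "t *\<^sub>R x"] by simp
  qed
  with add have "linear m" by (auto intro: linearI)
  with m(2) that show thesis by blast
qed

text \<open>Tilting the norm towards \<open>a\<close> before passing to a linear minorant takes the
  place of extending a functional from the line through \<open>a\<close>: the minorant is at most
  \<open>- norm a\<close> at \<open>- a\<close>, hence at least \<open>norm a\<close> at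
  \<open>a\<close>.\<close>

lemma exists_real_functional:
  fixes a :: "'a::real_normed_vector"
  obtains f :: "'a \<Rightarrow> real" where "linear f" "\<And>x. \<bar>f x\<bar> \<le> norm x" "norm a \<le> f a"
proof -
  have sub: "sublinear (norm :: 'a \<Rightarrow> real)"
    by (rule sublinearI) (auto intro: norm_triangle_ineq)
  obtain f where f: "linear f" "f \<le> tilt a norm"
    using exists_linear_below_sublinear[OF sublinear_tilt[OF sub]] by blast
  have le: "f x \<le> norm x" for x
    using f(2) tilt_le_self[OF sub, of a] by (meson le_fun_def order_trans)
  have neg: "f (- x) = - f x" for x using f(1) by (rule linear_neg)
  have "\<bar>f x\<bar> \<le> norm x" for x using le[of x] le[of "- x"] neg[of x] by simp
  moreover have "f (- a) \<le> - norm a"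
    using f(2) tilt_le[OF sub, of 1 a "- a"] by (auto simp: le_fun_def intro: order_trans)
  then have "norm a \<le> f a" by (simp add: neg)
  ultimately show thesis using f(1) that by blast
qed

section \<open>Functionals that are linear over the scalar field\<close>

context banach_space_over
begin

lemma scal_scaleR_commute: "scal c (r *\<^sub>R x) = r *\<^sub>R scal c x"
  by (metis mult.commute scal_of_real scale_scale)

lemma exists_functional_nonzero:
  assumes "z \<noteq> 0"
  obtains g where "Vector_Spaces.linear scal (*) g" "bounded_linear g" "g z \<noteq> (0::'k)"
proof -
  obtain f :: "'a \<Rightarrow> real" where f: "linear f" "\<And>x. \<bar>f x\<bar> \<le> norm x" "norm z \<le> f z"
    using exists_real_functional by blast
  have fz: "f z > 0" using f(3) assms by (meson less_le_trans zero_less_norm_iff)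
  have add: "f (x + y) = f x + f y" and scl: "f (r *\<^sub>R x) = r * f x" for x y r
    using f(1) by (auto simp: linear_add linear_scale)
  have neg: "f (- x) = - f x" for x using f(1) by (rule linear_neg)
  have vs: "vector_space ((*) :: 'k \<Rightarrow> _)"
    by standard (auto simp: algebra_simps)
  have lin: "Vector_Spaces.linear scal (*) g"
    if "\<And>x y. g (x + y) = g x + g y" "\<And>c x. g (scal c x) = c * g x" for g :: "'a \<Rightarrow> 'k"
    unfolding Vector_Spaces.linear_iff using that vector_space_axioms vs by blast
  consider "\<forall>z::'k. \<exists>a. z = a *\<^sub>R 1"
    | i where "i * i = (- 1::'k)" "\<forall>z::'k. \<exists>a b. z = a *\<^sub>R 1 + b *\<^sub>R i"
    using real_or_complex by blast
  then show thesis
  proof cases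
    case 1
    define g :: "'a \<Rightarrow> 'k" where "g x = of_real (f x)" for x
    have "g (scal c x) = c * g x" for c x
    proof -
      obtain r where "c = of_real r" using 1 by (metis of_real_def)
      then show ?thesis by (simp add: g_def scal_of_real scl)
    qed
    moreover have "bounded_linear g"
      by (rule bounded_linear_intro[where K = 1])
        (auto simp: g_def add scl f(2) scaleR_conv_of_real)
    moreover have "g z \<noteq> 0" using fz by (simp add: g_def)
    moreover have "g (x + y) = g x + g y" for x y by (simp add: g_def add)
    ultimately show thesis using that lin by blast
  next
    case (2 i)
    have "norm i * norm i = 1" using 2(1) by (metis norm_minus_cancel norm_mult norm_one)
    then have ni: "norm i = 1"
      by (metis abs_norm_cancel abs_square_eq_1 power2_eq_square)
    \<comment> \<open>The usual complexification, which has \<open>f\<close> as its real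
      part.\<close>
    define g :: "'a \<Rightarrow> 'k" where "g x = of_real (f x) - i * of_real (f (scal i x))" for x
    have g_add: "g (x + y) = g x + g y" for x y
      by (simp add: g_def add scale_right_distrib algebra_simps)
    have g_real: "g (r *\<^sub>R x) = of_real r * g x" for r x
      by (simp add: g_def scl scal_scaleR_commute algebra_simps)
    have g_i: "g (scal i x) = i * g x" for x
    proof -
      have "scal i (scal i x) = - x" using 2(1) by simp
      then have "g (scal i x) = of_real (f (scal i x)) + i * of_real (f x)"
        by (simp add: g_def neg)
      also have "\<dots> = i * of_real (f x) - (i * i) * of_real (f (scal i x))"
        using 2(1) by simp
      also have "\<dots> = i * g x" by (simp add: g_def algebra_simps)
      finally show ?thesis .
    qed
    have g_scal: "g (scal c x) = c * g x" for c x
    proof -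
      obtain a b where c: "c = of_real a + of_real b * i" using 2(2)
        by (metis mult.right_neutral mult_scaleR_left of_real_def scaleR_conv_of_real)
      have "scal c x = a *\<^sub>R x + b *\<^sub>R scal i x"
        unfolding c scale_left_distrib scale_scale[symmetric] scal_of_real ..
      then have "g (scal c x) = of_real a * g x + of_real b * (i * g x)"
        by (simp add: g_add g_real g_i)
      then show ?thesis unfolding c by (simp add: algebra_simps)
    qed
    have "bounded_linear g"
    proof (rule bounded_linear_intro[where K = 2])
      fix x
      have "norm (g x) \<le> \<bar>f x\<bar> + \<bar>f (scal i x)\<bar>"
        unfolding g_def by (rule order_trans[OF norm_triangle_ineq4]) (simp add: norm_mult ni)
      also have "\<dots> \<le> norm x * 2"
        using f(2)[of x] f(2)[of "scal i x"] by (simp add: norm_scal ni)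
      finally show "norm (g x) \<le> norm x * 2" .
    qed (auto simp: g_add g_real scaleR_conv_of_real)
    moreover have "g z \<noteq> 0"
    proof
      assume gz: "g z = 0"
      have "of_real (f z) = i * (of_real (f (scal i z)) :: 'k)" using gz by (simp add: g_def)
      \<comment> \<open>Squaring removes \<open>i\<close> and leaves an identity between real
        numbers, in which a positive number equals minus a square.\<close>
      then have "of_real (f z) * of_real (f z)
          = (i * i) * (of_real (f (scal i z)) * of_real (f (scal i z)) :: 'k)"
        by simp
      then have "(of_real (f z * f z) :: 'k) = of_real (- (f (scal i z) * f (scal i z)))"
        using 2(1) by simp
      then have "f z * f z = - (f (scal i z) * f (scal i z))" by (metis of_real_eq_iff)
      moreover have "f z * f z > 0" using fz by simp
      ultimately show False using zero_le_square[of "f (scal i z)"] by linarith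
    qed
    ultimately show thesis using that lin g_add g_scal by blast
  qed
qed

lemma exists_functional_one:
  assumes "z \<noteq> 0"
  obtains g where "Vector_Spaces.linear scal (*) g" "bounded_linear g" "g z = (1::'k)"
proof -
  obtain h where h: "Vector_Spaces.linear scal (*) h" "bounded_linear h" "h z \<noteq> (0::'k)"
    using assms by (rule exists_functional_nonzero)
  have "Vector_Spaces.linear scal (*) (\<lambda>x. h x / h z)"
    using h(1) unfolding Vector_Spaces.linear_iff by (simp add: add_divide_distrib)
  moreover have "bounded_linear (\<lambda>x. h x / h z)"
    using bounded_linear_compose[OF bounded_linear_divide h(2)] by (simp add: comp_def)
  ultimately show thesis using that[of "\<lambda>x. h x / h z"] h(3) by simp
qed

end

section \<open>Frequently hypercyclic vectors\<close>

lemma map_prod_funpow: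
  fixes f :: "'a \<Rightarrow> 'a" and g :: "'b \<Rightarrow> 'b"
  shows "(map_prod f g ^^ n) (x, y) = ((f ^^ n) x, (g ^^ n) y)"
  by (induction n) auto

lemma lower_density_empty: "lower_density {} = 0"
  by (simp add: lower_density_def Liminf_const zero_ereal_def[symmetric])

lemma frequently_hypercyclic_vector_hits:
  assumes "frequently_hypercyclic_vector R y" "open U" "U \<noteq> {}"
  obtains n where "(R ^^ n) y \<in> U"
proof -
  have "0 < lower_density {n. (R ^^ n) y \<in> U}"
    using assms unfolding frequently_hypercyclic_vector_def by blast
  then have "{n. (R ^^ n) y \<in> U} \<noteq> {}" using lower_density_empty by fastforce
  then show thesis using that by blast
qed

text \<open>The visits of the orbit of \<open>x\<close> to \<open>U\<close> occur at the same times
  as those of the orbit of \<open>y\<close> to the preimage of \<open>U\<close>, which is open by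
  continuity and non-empty by surjectivity.\<close>

lemma frequently_hypercyclic_vector_factor:
  fixes Q :: "'a::topological_space \<Rightarrow> 'a" and R :: "'b::topological_space \<Rightarrow> 'b"
    and \<Phi> :: "'a \<Rightarrow> 'b"
  assumes y: "frequently_hypercyclic_vector Q y"
    and \<Phi>: "continuous_on UNIV \<Phi>" "surj \<Phi>"
    and orbit: "\<And>n. (R ^^ n) x = \<Phi> ((Q ^^ n) y)"
  shows "frequently_hypercyclic_vector R x"
  unfolding frequently_hypercyclic_vector_def
proof (intro allI impI)
  fix U :: "'b set" assume "open U \<and> U \<noteq> {}"
  then have U: "open U" "U \<noteq> {}" by auto
  have "open (\<Phi> -` U)" using U(1) \<Phi>(1) by (rule open_vimage)
  moreover have "\<Phi> -` U \<noteq> {}" using U(2) \<Phi>(2) by (metis empty_iff ex_in_conv surjD vimageI2)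
  ultimately have "0 < lower_density {n. (Q ^^ n) y \<in> \<Phi> -` U}"
    using y unfolding frequently_hypercyclic_vector_def by blast
  then show "0 < lower_density {n. (R ^^ n) x \<in> U}" by (simp add: orbit)
qed

lemma bounded_linear_funpow:
  fixes T :: "'a::real_normed_vector \<Rightarrow> 'a"
  assumes "bounded_linear T"
  shows "bounded_linear (T ^^ n)"
proof (induction n)
  case 0
  show ?case using bounded_linear_ident by (simp add: id_def)
next
  case (Suc n)
  show ?case using bounded_linear_compose[OF assms Suc] by (simp add: comp_def)
qed

text \<open>The strict inequality \<open>0 < c\<close> matters: the lemma serves to leave the kernel
  of a functional and to give \<open>w\<close> a non-zero coefficient without leaving an open
  set.\<close>

lemma open_contains_translate:
  fixes U :: "'a::real_normed_vector set"
  assumes "open U" "u \<in> U"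
  obtains c where "0 < c" "c *\<^sub>R w + u \<in> U"
proof -
  have "((\<lambda>c. c *\<^sub>R w + u) \<longlongrightarrow> 0 *\<^sub>R w + u) (at_right 0)"
    by (intro tendsto_intros)
  then have "\<forall>\<^sub>F c in at_right 0. c *\<^sub>R w + u \<in> U"
    using assms by (auto dest: topological_tendstoD)
  then have "\<forall>\<^sub>F c in at_right 0. 0 < c \<and> c *\<^sub>R w + u \<in> U"
    using eventually_at_right_less[of 0] by eventually_elim simp
  then show thesis using that eventually_happens'[OF trivial_limit_at_right_real] by blast
qed

section \<open>Rank-one perturbations of the identity\<close>

locale rank_one_conjugation = banach_space_over scal
  for scal :: "'k::real_or_complex \<Rightarrow> 'a::banach \<Rightarrow> 'a" +
  fixes g :: "'a \<Rightarrow> 'k" and z :: 'a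
  assumes linear_g: "Vector_Spaces.linear scal (*) g"
    and bounded_linear_g: "bounded_linear g"
    and g_z: "g z = 1"
begin

text \<open>The inverse of \<open>I + g(.) z\<close> is \<open>I - g(.) z / (1 + g z)\<close>, and
  \<open>g z = 1\<close> makes the denominator 2.\<close>

definition J :: "'a \<Rightarrow> 'a" where "J x = x - scal (g x / 2) z"

definition J_inv :: "'a \<Rightarrow> 'a" where "J_inv x = x + scal (g x) z"

lemma g_add: "g (x + y) = g x + g y" and g_scal: "g (scal c x) = c * g x"
  using linear_g unfolding Vector_Spaces.linear_iff by auto

lemma g_diff: "g (x - y) = g x - g y" and g_scaleR: "g (r *\<^sub>R x) = r *\<^sub>R g x"
  using bounded_linear_g by (simp_all add: bounded_linear.linear linear_diff linear_scale)

lemma J_J_inv: "J (J_inv x) = x" and J_inv_J: "J_inv (J x) = x"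
proof -
  have "scal (g x / 2) z + scal (g x / 2) z = scal (g x) z"
    by (simp flip: scale_left_distrib)
  then show "J (J_inv x) = x" "J_inv (J x) = x"
    by (simp_all add: J_def J_inv_def g_add g_diff g_scal g_z field_simps
        scale_left_distrib scale_left_diff_distrib)
qed

lemma bounded_linear_scal_g: "bounded_linear (\<lambda>x. scal (g x) z)"
proof -
  obtain K where K: "\<And>x. norm (g x) \<le> norm x * K"
    using bounded_linear.bounded[OF bounded_linear_g] by blast
  show ?thesis
  proof (rule bounded_linear_intro)
    fix x
    show "norm (scal (g x) z) \<le> norm x * (K * norm z)"
      using mult_right_mono[OF K[of x] norm_ge_zero[of z]]
      by (simp add: norm_scal mult.assoc)
  next
    fix r x
    show "scal (g (r *\<^sub>R x)) z = r *\<^sub>R scal (g x) z"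
      unfolding g_scaleR by (simp add: scaleR_conv_of_real flip: scal_of_real)
  qed (simp add: g_add scale_left_distrib)
qed

lemma J_bounded_operator: "J \<in> bounded_operators scal"
proof -
  have half: "scal (g x / 2) z = (1 / 2) *\<^sub>R scal (g x) z" for x
    by (simp flip: scal_of_real)
  have "bounded_linear J"
    unfolding J_def[abs_def] half
    by (intro bounded_linear_sub bounded_linear_ident bounded_linear_const_scaleR
        bounded_linear_scal_g)
  moreover have "Vector_Spaces.linear scal scal J"
    unfolding Vector_Spaces.linear_iff
    by (simp add: vector_space_axioms J_def g_add g_scal add_divide_distrib
        scale_left_distrib scale_right_diff_distrib)
  ultimately show ?thesis by (simp add: bounded_operators_def)
qed

lemma J_inv_bounded_operator: "J_inv \<in> bounded_operators scal"
proof -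
  have "bounded_linear J_inv"
    unfolding J_inv_def[abs_def]
    by (intro bounded_linear_add bounded_linear_ident bounded_linear_scal_g)
  moreover have "Vector_Spaces.linear scal scal J_inv"
    unfolding Vector_Spaces.linear_iff
    by (simp add: vector_space_axioms J_inv_def g_add g_scal
        scale_left_distrib scale_right_distrib)
  ultimately show ?thesis by (simp add: bounded_operators_def)
qed

lemma conjugate_bounded_operator:
  assumes "T \<in> bounded_operators scal"
  shows "J \<circ> T \<circ> J_inv \<in> bounded_operators scal"
  using assms J_bounded_operator J_inv_bounded_operator
  unfolding bounded_operators_def
  by (auto simp: comp_def Vector_Spaces.linear_iff
      intro: bounded_linear_compose[of J] bounded_linear_compose[of T])

lemma conjugate_funpow: "((J \<circ> T \<circ> J_inv) ^^ n) x = J ((T ^^ n) (J_inv x))"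
  by (induction n) (simp_all add: J_J_inv J_inv_J)

lemma continuous_J: "continuous_on S J" and continuous_J_inv: "continuous_on S J_inv"
  and continuous_g: "continuous_on S g"
  using J_bounded_operator J_inv_bounded_operator bounded_linear_g
  unfolding bounded_operators_def by (auto intro: linear_continuous_on)

lemma bounded_operator_funpow_scal:
  assumes "T \<in> bounded_operators scal"
  shows "(T ^^ n) (scal c x) = scal c ((T ^^ n) x)"
  using assms unfolding bounded_operators_def
  by (induction n) (auto simp: Vector_Spaces.linear_iff)

text \<open>Together with \<open>conjugate_funpow\<close> this expresses the orbit of
  \<open>x\<close> under the conjugate through the orbits of \<open>x\<close> and \<open>z\<close>
  under \<open>T\<close>.\<close>

lemma funpow_J_inv:
  assumes T: "T \<in> bounded_operators scal"
  shows "(T ^^ n) (J_inv x) = (T ^^ n) x + scal (g x) ((T ^^ n) z)"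
proof -
  have "linear (T ^^ n)"
    using T bounded_linear_funpow bounded_linear.linear unfolding bounded_operators_def by blast
  then show ?thesis
    by (simp add: J_inv_def linear_add bounded_operator_funpow_scal[OF T])
qed

text \<open>For \<open>S = J \<circ> T \<circ> J_inv\<close> one has
  \<open>J_inv (S\<^sup>n u) - T\<^sup>n u = g(u) T\<^sup>n z\<close>. If \<open>g\<close> is of size about \<open>1\<close> at both
  \<open>u\<^sub>1\<close> and \<open>u\<^sub>2\<close>, these differences have comparable norms and cannot be prescribed
  independently.\<close>
lemma not_d_weakly_mixing_conjugate:
  assumes T: "T \<in> bounded_operators scal"
  shows "\<not> d_weakly_mixing T (J \<circ> T \<circ> J_inv)"
proof
  let ?S = "J \<circ> T \<circ> J_inv"
  assume mix: "d_weakly_mixing T ?S"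
  have z: "z \<noteq> 0" using g_z linear_0[OF bounded_linear.linear[OF bounded_linear_g]] by auto
  \<comment> \<open>The constants are chosen to clash: at \<open>u1\<close> the difference has norm
    below 1/2 + 1/2 = 1, so \<open>norm ((T ^^ n) z) < 2\<close>; at \<open>u2\<close> it is then
    below 4, yet it must exceed 5 - 1/2.\<close>
  define U where "U = {x. 1/2 < norm (g x) \<and> norm (g x) < 2}"
  define W1 where "W1 = {x. norm (J_inv x) < 1/2}"
  define W2 where "W2 = {x. 5 < norm (J_inv x)}"
  have "open U" "open W1" "open W2"
    unfolding U_def W1_def W2_def
    by (intro open_Collect_conj open_Collect_less continuous_intros continuous_g continuous_J_inv)+
  moreover have "z \<in> U" by (simp add: U_def g_z)
  moreover have "J 0 \<in> W1" by (simp add: W1_def J_inv_J)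
  moreover have "J ((6 / norm z) *\<^sub>R z) \<in> W2" using z by (simp add: W2_def J_inv_J)
  ultimately have "open (U \<times> U)" "U \<times> U \<noteq> {}" "open (W1 \<times> W2)" "W1 \<times> W2 \<noteq> {}"
    by (auto intro: open_Times)
  moreover have "open (ball (0::'a) (1/2) \<times> ball (0::'a) (1/2))"
    "ball (0::'a) (1/2) \<times> ball (0::'a) (1/2) \<noteq> {}"
    by (auto intro: open_Times)
  ultimately obtain n where
    "(U \<times> U) \<inter> (map_prod T T ^^ n) -` (ball 0 (1/2) \<times> ball 0 (1/2))
       \<inter> (map_prod ?S ?S ^^ n) -` (W1 \<times> W2) \<noteq> {}"
    using mix unfolding d_weakly_mixing_def d_topologically_transitive_def by meson
  then obtain u1 u2 where u: "u1 \<in> U" "u2 \<in> U"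
    and Tu: "norm ((T ^^ n) u1) < 1/2" "norm ((T ^^ n) u2) < 1/2"
    and Su: "(?S ^^ n) u1 \<in> W1" "(?S ^^ n) u2 \<in> W2"
    by (auto simp: map_prod_funpow simp del: comp_apply)
  let ?v = "(T ^^ n) z"
  have S1: "norm ((T ^^ n) u1 + scal (g u1) ?v) < 1/2"
    and S2: "5 < norm ((T ^^ n) u2 + scal (g u2) ?v)"
    using Su by (simp_all add: W1_def W2_def conjugate_funpow J_inv_J funpow_J_inv[OF T])
  have "norm (scal (g u1) ?v) < 1"
    using S1 Tu(1) norm_triangle_ineq4[of "(T ^^ n) u1 + scal (g u1) ?v" "(T ^^ n) u1"] by simp
  moreover have "norm (scal (g u1) ?v) \<ge> (1/2) * norm ?v"
    using u(1) unfolding norm_scal U_def by (intro mult_right_mono) auto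
  moreover have "norm (scal (g u2) ?v) > 4"
    using S2 Tu(2) norm_triangle_ineq[of "(T ^^ n) u2" "scal (g u2) ?v"] by simp
  moreover have "norm (scal (g u2) ?v) \<le> 2 * norm ?v"
    using u(2) unfolding norm_scal U_def by (intro mult_right_mono) auto
  ultimately show False by simp
qed

text \<open>The orbit of \<open>(x, x)\<close> is the image of the orbit of \<open>(w, z)\<close> under
  \<open>(a, b) \<mapsto> (a', J (a' + g(x) b))\<close>, where \<open>a' = c a + T\<^sup>k b\<close>.\<close>
lemma d_frequently_hypercyclic_vector_conjugate:
  assumes T: "T \<in> bounded_operators scal"
    and wz: "frequently_hypercyclic_vector (map_prod T T) (w, z)"
    and x: "x = c *\<^sub>R w + (T ^^ k) z" and c: "c \<noteq> 0" and gx: "g x \<noteq> 0"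
  shows "d_frequently_hypercyclic_vector T (J \<circ> T \<circ> J_inv) x"
proof -
  let ?S = "J \<circ> T \<circ> J_inv"
  have bl: "bounded_linear (T ^^ n)" for n
    using T bounded_linear_funpow unfolding bounded_operators_def by blast
  have lin: "(T ^^ n) (a + b) = (T ^^ n) a + (T ^^ n) b" "(T ^^ n) (r *\<^sub>R a) = r *\<^sub>R (T ^^ n) a"
    for n a b r
    using bounded_linear.linear[OF bl] by (simp_all add: linear_add linear_scale)
  define h where "h p = c *\<^sub>R fst p + (T ^^ k) (snd p)" for p
  define \<Phi> where "\<Phi> p = (h p, J (h p + scal (g x) (snd p)))" for p
  have "bounded_linear (scal (g x))"
    by (rule bounded_linear_intro[where K = "norm (g x)"])
      (simp_all add: scale_right_distrib scal_scaleR_commute norm_scal)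
  then have "continuous_on UNIV \<Phi>"
    unfolding \<Phi>_def h_def
    by (intro continuous_intros bounded_linear.continuous_on[OF bl]
        continuous_on_compose2[OF continuous_J] bounded_linear.continuous_on[of "scal (g x)"]) auto
  moreover have "surj \<Phi>"
  proof (rule surjI)
    fix q :: "'a \<times> 'a"
    \<comment> \<open>Solving for the preimage of \<open>q\<close>: the first component prescribes
      \<open>a' = fst q\<close>, so the second determines \<open>b\<close> from
      \<open>J_inv (snd q) = a' + g(x) b\<close>, using \<open>g x \<noteq> 0\<close>; then
      \<open>a\<close> follows from \<open>a' = c a + T^k b\<close>, using
      \<open>c \<noteq> 0\<close>.\<close>
    let ?b = "scal (1 / g x) (J_inv (snd q) - fst q)"
    show "\<Phi> ((1 / c) *\<^sub>R (fst q - (T ^^ k) ?b), ?b) = q"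
      using c gx by (simp add: \<Phi>_def h_def J_J_inv)
  qed
  moreover have "(map_prod T ?S ^^ n) (x, x) = \<Phi> ((map_prod T T ^^ n) (w, z))" for n
  proof -
    have "(T ^^ n) ((T ^^ k) z) = (T ^^ k) ((T ^^ n) z)"
      by (metis add.commute comp_apply funpow_add)
    then have "h ((T ^^ n) w, (T ^^ n) z) = (T ^^ n) x"
      by (simp add: h_def x lin)
    then show ?thesis
      by (simp add: map_prod_funpow \<Phi>_def conjugate_funpow funpow_J_inv[OF T] del: comp_apply)
  qed
  ultimately show ?thesis
    unfolding d_frequently_hypercyclic_vector_def
    using frequently_hypercyclic_vector_factor[OF wz] by blast
qed

lemma densely_d_frequently_hypercyclic_conjugate:
  assumes T: "T \<in> bounded_operators scal"
    and wz: "frequently_hypercyclic_vector (map_prod T T) (w, z)"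
  shows "densely_d_frequently_hypercyclic T (J \<circ> T \<circ> J_inv)"
  unfolding densely_d_frequently_hypercyclic_def
proof (rule ccontr)
  let ?D = "{x. d_frequently_hypercyclic_vector T (J \<circ> T \<circ> J_inv) x}"
  assume "closure ?D \<noteq> UNIV"
  then obtain u where u: "u \<in> - closure ?D" by blast
  define V where "V = - closure ?D \<inter> {x. g x \<noteq> 0}"
  have V: "open V"
    unfolding V_def
    by (intro open_Int open_Compl closed_closure open_Collect_neq continuous_g continuous_on_const)
  \<comment> \<open>The kernel of \<open>g\<close> has empty interior: moving a point along
    \<open>z\<close> changes its value under \<open>g\<close>, as \<open>g z = 1\<close>.\<close>
  have "V \<noteq> {}"
  proof (cases "g u = 0")
    case True
    obtain t where "0 < t" "t *\<^sub>R z + u \<in> - closure ?D"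
      using open_contains_translate[OF open_Compl[OF closed_closure] u] by blast
    moreover have "g (t *\<^sub>R z + u) = of_real t"
      by (simp add: g_add g_scaleR g_z True of_real_def)
    ultimately show ?thesis unfolding V_def by force
  next
    case False
    then show ?thesis using u unfolding V_def by blast
  qed
  \<comment> \<open>The orbit of \<open>z\<close> under \<open>T\<close> is dense, as the second
    component of a dense orbit in the product.\<close>
  then obtain k where "(map_prod T T ^^ k) (w, z) \<in> UNIV \<times> V"
    using frequently_hypercyclic_vector_hits[OF wz, of "UNIV \<times> V"] V open_Times[OF open_UNIV V]
    by blast
  then have "(T ^^ k) z \<in> V" by (simp add: map_prod_funpow)
  \<comment> \<open>Staying in the open set \<open>V\<close> keeps \<open>g\<close> non-zero at the
    perturbed point, which therefore belongs to \<open>?D\<close> although \<open>V\<close> avoids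
    its closure.\<close>
  then obtain c where c: "0 < c" "c *\<^sub>R w + (T ^^ k) z \<in> V"
    using open_contains_translate[OF V] by blast
  then have "c *\<^sub>R w + (T ^^ k) z \<in> ?D"
    using d_frequently_hypercyclic_vector_conjugate[OF T wz refl] unfolding V_def by simp
  then show False using c(2) closure_subset unfolding V_def by blast
qed

end

theorem theorem2p3:
  fixes scal :: "'k::real_or_complex \<Rightarrow> 'a::banach \<Rightarrow> 'a"
    and T :: "'a \<Rightarrow> 'a"
  assumes "banach_space_over scal"
    and "separable_space (euclidean :: 'a topology)"
    and "infinite_dimensional scal"
    and "T \<in> bounded_operators scal"
    and "frequently_hypercyclic (map_prod T T)"
  shows "\<exists>S \<in> bounded_operators scal.
           densely_d_frequently_hypercyclic T S \<and> \<not> d_weakly_mixing T S"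
proof -
  interpret banach_space_over scal by fact
  obtain w z where wz: "frequently_hypercyclic_vector (map_prod T T) (w, z)"
    using assms(5) unfolding frequently_hypercyclic_def by (metis surj_pair)
  \<comment> \<open>A functional with value 1 at \<open>z\<close> requires
    \<open>z \<noteq> 0\<close>. Since the space is non-trivial, the orbit of \<open>z\<close> has
    to reach a non-zero vector, whereas the orbit of 0 stays at 0.\<close>
  have "(UNIV :: 'a set) \<noteq> {0}"
    using assms(3) span_empty unfolding infinite_dimensional_def by (metis finite.emptyI)
  then have "UNIV \<times> - {0::'a} \<noteq> ({} :: ('a \<times> 'a) set)" by auto
  moreover have "open (UNIV \<times> - {0::'a} :: ('a \<times> 'a) set)" by (intro open_Times) auto
  ultimately obtain n where "(map_prod T T ^^ n) (w, z) \<in> UNIV \<times> - {0}"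
    using frequently_hypercyclic_vector_hits[OF wz] by metis
  then have "(T ^^ n) z \<noteq> 0" by (simp add: map_prod_funpow)
  moreover have "(T ^^ n) 0 = 0"
    using assms(4) bounded_linear_funpow[of T n] linear_0 bounded_linear.linear
    unfolding bounded_operators_def by blast
  ultimately have "z \<noteq> 0" by metis
  then obtain g where g: "Vector_Spaces.linear scal (*) g" "bounded_linear g" "g z = 1"
    by (rule exists_functional_one)
  interpret rank_one_conjugation scal g z
    using g by (intro rank_one_conjugation.intro rank_one_conjugation_axioms.intro
        banach_space_over_axioms)
  show ?thesis
    using conjugate_bounded_operator[OF assms(4)] not_d_weakly_mixing_conjugate[OF assms(4)]
      densely_d_frequently_hypercyclic_conjugate[OF assms(4) wz] by blast
qed

end
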